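(* For every pair of convex bodies $C, D\subset\mathbb{R}^2$, and every packing $S$ of $n$ positive homothets of $C$ in $D$, where each element of $S$ touches the boundary of $D$, we have $$\mathrm{per}(S)\le \rho(C,D)\,\log n,$$ where $\rho(C,D)$ depends on $C$ and $D$ (and not on $n$ or $S$).
   Context: A convex body is a compact convex subset of $\mathbb{R}^2$ with nonempty interior. A positive homothet of $C$ is a set of the form $\mu C + v$ with $\mu>0$ and $v\in\mathbb{R}^2$. A finite set $S=\{C_1,\dots,C_n\}$ of convex bodies is a packing in a convex body $D$ if all $C_i$ are contained in $D$ and the $C_i$ have pairwise disjoint interiors. An element $C_i$ touches the boundary of $D$ if $C_i\cap\partial D\neq\emptyset$. $\mathrm{per}(C)$ denotes the perimeter of a convex body $C$, and $\mathrm{per}(S)=\sum_{i=1}^n \mathrm{per}(C_i)$. $\log$ denotes the logarithm to base 2.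
   Formalization: The formal theorem assumes n ≥ 2: for n = 1 the printed inequality would read per(S) ≤ 0, since log 1 = 0, which fails for every packing of a single body, and for n = 0 log n is undefined. *)

theory Defs
  imports "HOL-Analysis.Analysis"
begin

definition convex_body :: "(real^2) set \<Rightarrow> bool" where
  "convex_body C \<longleftrightarrow> compact C \<and> convex C \<and> interior C \<noteq> {}"

definition positive_homothet :: "(real^2) set \<Rightarrow> (real^2) set \<Rightarrow> bool" where
  "positive_homothet C K \<longleftrightarrow> (\<exists>\<mu>>0. \<exists>v. K = (\<lambda>x. \<mu> *\<^sub>R x + v) ` C)"

definition packing_in :: "(real^2) set \<Rightarrow> (real^2) set set \<Rightarrow> bool" where
  "packing_in D S \<longleftrightarrow>
     finite S \<and> (\<forall>K\<in>S. convex_body K \<and> K \<subseteq> D) \<and>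
     pairwise (\<lambda>K L. interior K \<inter> interior L = {}) S"

definition touches_boundary :: "(real^2) set \<Rightarrow> (real^2) set \<Rightarrow> bool" where
  "touches_boundary D K \<longleftrightarrow> K \<inter> frontier D \<noteq> {}"

text \<open>The length of a plane set is its one-dimensional Hausdorff measure. In dimension one the
  sum of the diameters needs no normalising constant: a segment gets its usual length. The
  boundedness condition is there because \<^const>\<open>diameter\<close> is a real number, with no meaningful
  value on unbounded sets.\<close>

definition length_at_scale :: "real \<Rightarrow> (real^2) set \<Rightarrow> ennreal" where
  "length_at_scale \<delta> A =
     (INF U \<in> {U :: nat \<Rightarrow> (real^2) set. A \<subseteq> (\<Union>i. U i) \<and> (\<forall>i. bounded (U i) \<and> diameter (U i) \<le> \<delta>)}.
        \<Sum>i. ennreal (diameter (U i)))"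

definition hausdorff_length :: "(real^2) set \<Rightarrow> ennreal" where
  "hausdorff_length A = (SUP \<delta> \<in> {0<..}. length_at_scale \<delta> A)"

definition perimeter :: "(real^2) set \<Rightarrow> ennreal" where
  "perimeter C = hausdorff_length (frontier C)"

end

theory Submission
  imports Defs
begin

text \<open>All members of the packing with scale about \<open>\<mu>\<close> lie in a layer of width \<open>O(\<mu>)\<close> along the
  boundary of \<open>D\<close>. That layer has area \<open>O(\<mu>)\<close> and each of these members has area of order \<open>\<mu>\<^sup>2\<close>, so
  there are \<open>O(1/\<mu>)\<close> of them and their total perimeter is \<open>O(1)\<close>. Scales are bounded above by
  some \<open>M\<close>; summing over the dyadic classes down to scale \<open>M/n\<close> gives \<open>O(log n)\<close>, and the
  remaining members, at most \<open>n\<close> of scale at most \<open>M/n\<close>, contribute \<open>O(1)\<close>.\<close>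

subsection \<open>Length of Lipschitz curves\<close>

text \<open>Cutting \<open>{0..b}\<close> into \<open>N\<close> equal pieces gives \<open>N\<close>
  image sets of diameter at most \<open>L * b / N\<close>. Their total is at most
  \<open>L * b\<close> whatever \<open>N\<close> is, so the bound survives the supremum over
  \<delta>.\<close>

lemma length_at_scale_lipschitz_image:
  fixes f :: "real \<Rightarrow> real^2"
  assumes f: "L-lipschitz_on {0..b} f" and b: "0 < b" and \<delta>: "0 < \<delta>" and A: "A \<subseteq> f ` {0..b}"
  shows "length_at_scale \<delta> A \<le> ennreal (L * b)"
proof -
  have L0: "0 \<le> L" using f by (rule lipschitz_on_nonneg)
  obtain N0 :: nat where N0: "L * b / \<delta> < real N0" using reals_Archimedean2 by blast
  define N where "N = Suc N0"
  have N: "0 < N" "L * b / N \<le> \<delta>"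
    using N0 \<delta> by (auto simp: N_def field_simps)
  define I where "I i = {b * real i / N .. b * (real i + 1) / N} \<inter> {0..b}" for i :: nat
  \<comment> \<open>A cover must be a sequence indexed by all naturals. Padding with the empty set,
    whose diameter is 0, turns the series into a finite sum.\<close>
  define U where "U i = (if i < N then f ` I i else {})" for i
  have dist_I: "norm (f s - f t) \<le> L * b / N" if "s \<in> I i" "t \<in> I i" for s t i
  proof -
    have "\<bar>s - t\<bar> \<le> b * (real i + 1) / N - b * real i / N" using that by (auto simp: I_def)
    also have "\<dots> = b / N" by (simp add: add_divide_distrib distrib_left)
    finally have "L * \<bar>s - t\<bar> \<le> L * (b / N)" using L0 by (rule mult_left_mono)
    moreover have "norm (f s - f t) \<le> L * \<bar>s - t\<bar>"
      using lipschitz_on_normD[OF f, of s t] that unfolding I_def real_norm_def by blast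
    ultimately show ?thesis by simp
  qed
  have diam: "diameter (U i) \<le> L * b / N" for i
    by (rule diameter_le) (use L0 b dist_I in \<open>auto simp: U_def split: if_splits\<close>)
  have bdd: "bounded (U i)" for i
  proof (rule bounded_subset)
    show "bounded (f ` {0..b})"
      using lipschitz_on_continuous_on[OF f]
      by (intro compact_imp_bounded compact_continuous_image) auto
    show "U i \<subseteq> f ` {0..b}" by (auto simp: U_def I_def)
  qed
  have cover: "f ` {0..b} \<subseteq> (\<Union>i. U i)"
  proof
    fix y assume "y \<in> f ` {0..b}"
    then obtain t where t: "t \<in> {0..b}" "y = f t" by auto
    show "y \<in> (\<Union>i. U i)"
    \<comment> \<open>At the right endpoint the floor formula would give the index \<open>N\<close>,
      one too many, so this point goes to the last piece.\<close>
    proof (cases "t = b")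
      case True
      have "t \<in> I (N - 1)" using True t N b by (auto simp: I_def of_nat_diff field_simps)
      then show ?thesis using t N by (auto simp: U_def intro!: exI[of _ "N - 1"])
    next
      case False
      define i where "i = nat \<lfloor>t * N / b\<rfloor>"
      have nn: "0 \<le> t * N / b" using t b by auto
      have ri: "real i = of_int \<lfloor>t * N / b\<rfloor>" using nn by (simp add: i_def)
      have i: "real i \<le> t * N / b" "t * N / b < real i + 1" unfolding ri by linarith+
      have "t * N / b < N" using t False b N by (auto simp: field_simps)
      then have "i < N" using i by linarith
      moreover have "t \<in> I i" using i t b N by (auto simp: I_def field_simps)
      ultimately show ?thesis using t by (auto simp: U_def)
    qed
  qed
  have "length_at_scale \<delta> A \<le> (\<Sum>i. ennreal (diameter (U i)))"
    unfolding length_at_scale_def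
  proof (rule INF_lower)
    have "A \<subseteq> (\<Union>i. U i)" using A cover by (rule subset_trans)
    moreover have "diameter (U i) \<le> \<delta>" for i using diam[of i] N by linarith
    ultimately show "U \<in> {U. A \<subseteq> (\<Union>i. U i) \<and> (\<forall>i. bounded (U i) \<and> diameter (U i) \<le> \<delta>)}"
      using bdd by simp
  qed
  also have "\<dots> = (\<Sum>i<N. ennreal (diameter (U i)))"
    by (rule suminf_finite) (auto simp: U_def)
  also have "\<dots> \<le> (\<Sum>i<N. ennreal (L * b / N))"
    by (intro sum_mono ennreal_leI diam)
  also have "\<dots> = ennreal (\<Sum>i<N. L * b / N)"
    using L0 b by (intro sum_ennreal) auto
  also have "(\<Sum>i<N. L * b / N) = L * b" using N by simp
  finally show ?thesis .
qed

lemma hausdorff_length_lipschitz_image: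
  fixes f :: "real \<Rightarrow> real^2"
  assumes "L-lipschitz_on {0..b} f" "0 < b" "A \<subseteq> f ` {0..b}"
  shows "hausdorff_length A \<le> ennreal (L * b)"
  unfolding hausdorff_length_def
  by (rule SUP_least) (use length_at_scale_lipschitz_image[OF assms(1,2) _ assms(3)] in auto)

text \<open>The factor 2 comes from bounding the Euclidean norm by the sum of the coordinates'
  absolute values. Only finiteness of the constant matters later.\<close>

lemma lipschitz_circle:
  fixes R :: real
  assumes "0 \<le> R"
  shows "(2 * R)-lipschitz_on X (\<lambda>t. vector [R * cos t, R * sin t] :: real^2)"
proof (rule lipschitz_onI)
  fix s t :: real
  have c: "\<bar>cos s - cos t\<bar> \<le> \<bar>s - t\<bar>"
    using field_differentiable_bound[of UNIV cos "\<lambda>x. - sin x" 1 s t]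
    by (auto intro!: derivative_eq_intros)
  have s: "\<bar>sin s - sin t\<bar> \<le> \<bar>s - t\<bar>"
    using field_differentiable_bound[of UNIV sin cos 1 s t]
    by (auto intro!: derivative_eq_intros)
  let ?f = "\<lambda>t. vector [R * cos t, R * sin t] :: real^2"
  have "norm (?f s - ?f t) \<le> \<bar>R * cos s - R * cos t\<bar> + \<bar>R * sin s - R * sin t\<bar>"
    using norm_le_l1_cart[of "?f s - ?f t"] by (simp add: sum_2)
  also have "\<dots> = R * (\<bar>cos s - cos t\<bar> + \<bar>sin s - sin t\<bar>)"
    using assms by (simp add: abs_mult distrib_left flip: right_diff_distrib)
  also have "\<dots> \<le> R * (\<bar>s - t\<bar> + \<bar>s - t\<bar>)" using c s assms by (intro mult_left_mono) auto
  finally show "dist (?f s) (?f t) \<le> 2 * R * dist s t" by (simp add: dist_norm)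
qed (use assms in auto)

lemma sphere_subset_circle:
  fixes R :: real
  assumes "0 < R"
  shows "sphere 0 R \<subseteq> (\<lambda>t. vector [R * cos t, R * sin t] :: real^2) ` {0..2 * pi}"
proof
  fix x :: "real^2" assume "x \<in> sphere 0 R"
  moreover have "(x$1)\<^sup>2 + (x$2)\<^sup>2 = (norm x)\<^sup>2"
    unfolding power2_norm_eq_inner by (simp add: inner_vec_def sum_2 power2_eq_square)
  ultimately have "(x$1)\<^sup>2 + (x$2)\<^sup>2 = R\<^sup>2" by simp
  then have "(x$1 / R)\<^sup>2 + (x$2 / R)\<^sup>2 = 1"
    using assms by (simp add: power_divide flip: add_divide_distrib)
  then obtain t where t: "0 \<le> t" "t \<le> 2 * pi" "x$1 / R = cos t" "x$2 / R = sin t"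
    using sincos_total_2pi_le by blast
  then have "x = vector [R * cos t, R * sin t]"
    using assms by (simp add: vec_eq_iff forall_2 field_simps)
  then show "x \<in> (\<lambda>t. vector [R * cos t, R * sin t]) ` {0..2 * pi}" using t by auto
qed

subsection \<open>The perimeter of a homothet\<close>

text \<open>A boundary point is the nearest point of \<open>C\<close> to every point of the ray along an outer normal,
  and that ray leaves any ball around \<open>C\<close>.\<close>

lemma frontier_subset_closest_point_sphere:
  fixes C :: "'a::euclidean_space set"
  assumes "closed C" "convex C" "C \<noteq> {}" and CR: "C \<subseteq> ball 0 R"
  shows "frontier C \<subseteq> closest_point C ` sphere 0 R"
proof
  fix x assume x: "x \<in> frontier C"
  have xC: "x \<in> C" using x assms(1) frontier_subset_closed by blast
  obtain a where a: "a \<noteq> 0" "\<And>y. y \<in> C \<Longrightarrow> a \<bullet> x \<le> a \<bullet> y"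
  proof (cases "x \<in> rel_interior C")
    case False
    then show ?thesis
      using supporting_hyperplane_rel_boundary[OF assms(2) xC] that by metis
  next
    \<comment> \<open>A frontier point in the relative interior can occur only when \<open>C\<close>
      is flat. Then \<open>C\<close> lies in a hyperplane, whose normal is constant on
      \<open>C\<close> and hence supports it at \<open>x\<close>.\<close>
    case True
    then have "interior C = {}" using x rel_interior_nonempty_interior[of C]
      by (auto simp: frontier_def)
    then obtain a b where ab: "a \<noteq> 0" "C \<subseteq> {x. a \<bullet> x = b}"
      using empty_interior_subset_hyperplane[OF assms(2)] by metis
    then have "a \<bullet> y = b" if "y \<in> C" for y using that by auto
    then have "a \<bullet> x \<le> a \<bullet> y" if "y \<in> C" for y using xC that by simp
    with ab(1) show ?thesis by (rule that)
  qed
  have "norm x < R" using xC CR by auto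
  then have R: "0 < R" using norm_ge_zero[of x] by linarith
  have "x \<in> interior (ball 0 R)" using xC CR by (auto simp: interior_open)
  then obtain d where d: "0 < d" "x + d *\<^sub>R (- a) \<in> frontier (ball 0 R)"
    using ray_to_frontier[OF bounded_ball, of x 0 R "- a"] a(1) by auto
  let ?z = "x + d *\<^sub>R (- a)"
  have "dist ?z x \<le> dist ?z y" if "y \<in> C" for y
  proof -
    have "norm (?z - x) ^ 2 \<le> norm (?z - y) ^ 2"
    proof -
      \<comment> \<open>Since \<open>?z - x\<close> is \<open>- d\<close> times \<open>a\<close>,
        expanding around \<open>x\<close> leaves a cross term that the supporting inequality makes
        nonnegative.\<close>
      have "(?z - y) \<bullet> (?z - y) = (?z - x) \<bullet> (?z - x) + (x - y) \<bullet> (x - y) + 2 * d * (a \<bullet> y - a \<bullet> x)"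
        by (simp add: algebra_simps inner_commute)
      moreover have "0 \<le> 2 * d * (a \<bullet> y - a \<bullet> x)" using a(2)[OF that] d by auto
      moreover have "0 \<le> (x - y) \<bullet> (x - y)" by simp
      ultimately show ?thesis unfolding power2_norm_eq_inner by linarith
    qed
    then show ?thesis unfolding dist_norm by (rule power2_le_imp_le) simp
  qed
  then have "x = closest_point C ?z"
    by (intro closest_point_unique assms xC) auto
  moreover have "?z \<in> sphere 0 R" using d R by simp
  ultimately show "x \<in> closest_point C ` sphere 0 R" by blast
qed

text \<open>The projection onto a closed convex set is 1-Lipschitz and maps a surrounding circle
  onto a set containing the frontier. Composing it with the parametrised circle gives the
  curve.\<close>

lemma frontier_convex_body_lipschitz:
  assumes "convex_body C"
  obtains L f where "L-lipschitz_on {0..2 * pi} f" "frontier C \<subseteq> f ` {0..2 * pi}"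
proof -
  have C: "compact C" "convex C" "C \<noteq> {}" "closed C"
    using assms interior_subset by (auto simp: convex_body_def compact_imp_closed)
  obtain R where R: "0 < R" "C \<subseteq> ball 0 R"
    using bounded_subset_ballD[OF compact_imp_bounded[OF C(1)], of 0] by auto
  let ?c = "\<lambda>t. vector [R * cos t, R * sin t] :: real^2"
  have "1-lipschitz_on (?c ` {0..2 * pi}) (closest_point C)"
    by (rule lipschitz_onI) (use closest_point_lipschitz[OF C(2,4,3)] in auto)
  then have "(1 * (2 * R))-lipschitz_on {0..2 * pi} (closest_point C \<circ> ?c)"
    using R by (intro lipschitz_on_compose lipschitz_circle) auto
  moreover have "frontier C \<subseteq> (closest_point C \<circ> ?c) ` {0..2 * pi}"
    unfolding image_comp[symmetric]
    using frontier_subset_closest_point_sphere[OF C(4,2,3) R(2)]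
      image_mono[OF sphere_subset_circle[OF R(1)]] by (rule order_trans)
  ultimately show thesis by (rule that)
qed

text \<open>A homothety is open, so it sends interior points to interior points. This inclusion
  suffices because perimeters are only bounded from above.\<close>

lemma frontier_homothet_subset:
  fixes C :: "'a::real_normed_vector set"
  assumes "compact C" "\<mu> \<noteq> 0"
  shows "frontier ((\<lambda>x. \<mu> *\<^sub>R x + v) ` C) \<subseteq> (\<lambda>x. \<mu> *\<^sub>R x + v) ` frontier C"
proof -
  let ?g = "\<lambda>x. \<mu> *\<^sub>R x + v"
  have "open (?g ` interior C)"
    using open_affinity[OF open_interior assms(2), of v C] by (simp add: add.commute)
  then have "?g ` interior C \<subseteq> interior (?g ` C)"
    using interior_subset by (intro interior_maximal image_mono)
  moreover have "closed (?g ` C)"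
    using assms(1) by (intro compact_imp_closed compact_continuous_image continuous_intros)
  ultimately show ?thesis
    using assms(1) by (auto simp: frontier_def compact_imp_closed closure_closed)
qed

text \<open>One Lipschitz curve covering the frontier of \<open>C\<close> serves all homothets:
  following it by the homothety multiplies its Lipschitz constant by \<mu>.\<close>

lemma perimeter_homothet_le:
  assumes "convex_body C"
  obtains P where "0 \<le> P"
    and "\<And>\<mu> v. 0 < \<mu> \<Longrightarrow> perimeter ((\<lambda>x. \<mu> *\<^sub>R x + v) ` C) \<le> ennreal (\<mu> * P)"
proof -
  obtain L f where f: "L-lipschitz_on {0..2 * pi} f" and fr: "frontier C \<subseteq> f ` {0..2 * pi}"
    using frontier_convex_body_lipschitz[OF assms] .
  have "perimeter ((\<lambda>x. \<mu> *\<^sub>R x + v) ` C) \<le> ennreal (\<mu> * (L * (2 * pi)))" if "0 < \<mu>" for \<mu> v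
  proof -
    let ?g = "\<lambda>x. \<mu> *\<^sub>R x + v"
    have "(\<mu> * L)-lipschitz_on {0..2 * pi} (?g \<circ> f)"
    proof (rule lipschitz_on_compose[OF f])
      show "\<mu>-lipschitz_on (f ` {0..2 * pi}) ?g"
        by (rule lipschitz_onI)
          (use that in \<open>auto simp: dist_norm simp flip: scaleR_diff_right\<close>)
    qed
    moreover have "frontier (?g ` C) \<subseteq> (?g \<circ> f) ` {0..2 * pi}"
    proof -
      have "frontier (?g ` C) \<subseteq> ?g ` frontier C"
        using assms that by (intro frontier_homothet_subset) (auto simp: convex_body_def)
      also have "\<dots> \<subseteq> ?g ` f ` {0..2 * pi}" using fr by (rule image_mono)
      finally show ?thesis by (simp add: image_comp)
    qed
    ultimately have "perimeter (?g ` C) \<le> ennreal (\<mu> * L * (2 * pi))"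
      unfolding perimeter_def by (intro hausdorff_length_lipschitz_image) auto
    then show ?thesis by (simp add: mult.assoc)
  qed
  moreover have "0 \<le> L * (2 * pi)" using lipschitz_on_nonneg[OF f] by simp
  ultimately show thesis using that by blast
qed

subsection \<open>Area estimates\<close>

lemma measure_homothet:
  fixes C :: "(real^2) set"
  shows "measure lebesgue ((\<lambda>x. \<mu> *\<^sub>R x + v) ` C) = \<mu>\<^sup>2 * measure lebesgue C"
  using measure_lebesgue_affine[of \<mu> v C] by (simp add: power2_eq_square add.commute)

lemma measure_convex_body_pos:
  assumes "convex_body C"
  shows "0 < measure lebesgue C"
proof -
  have C: "C \<in> lmeasurable" "convex C" "interior C \<noteq> {}"
    using assms by (auto simp: convex_body_def lmeasurable_compact)
  then have "measure lebesgue C \<noteq> 0"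
    using negligible_convex_interior[OF C(2)] by (simp add: negligible_iff_measure)
  then show ?thesis using measure_nonneg[of lebesgue C] by linarith
qed

text \<open>Two members meet in a convex set without interior, which is negligible, so areas add up.
  \<open>E\<close> is separate from \<open>D\<close> so that it can be a thin layer along the
  boundary.\<close>

lemma sum_measure_packing_le:
  assumes S: "packing_in D S" and E: "E \<in> lmeasurable" "\<And>K. K \<in> S \<Longrightarrow> K \<subseteq> E"
  shows "(\<Sum>K\<in>S. measure lebesgue K) \<le> measure lebesgue E"
proof -
  have fin: "finite S" and body: "\<And>K. K \<in> S \<Longrightarrow> convex_body K"
    and disj: "pairwise (\<lambda>K L. interior K \<inter> interior L = {}) S"
    using S by (auto simp: packing_in_def)
  have lm: "K \<in> lmeasurable" if "K \<in> S" for K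
    using body[OF that] by (auto simp: convex_body_def lmeasurable_compact)
  have "pairwise (\<lambda>K L. negligible (K \<inter> L)) S"
  proof (rule pairwiseI)
    fix K L assume KL: "K \<in> S" "L \<in> S" "K \<noteq> L"
    then have "convex (K \<inter> L)" using body by (auto simp: convex_body_def intro: convex_Int)
    moreover have "interior (K \<inter> L) = {}" using disj KL by (auto simp: pairwise_def)
    ultimately show "negligible (K \<inter> L)" by (simp add: negligible_convex_interior)
  qed
  then have "(\<Sum>K\<in>S. measure lebesgue K) = measure lebesgue (\<Union>S)"
    using measure_negligible_finite_Union[OF fin lm] by simp
  also have "\<dots> \<le> measure lebesgue E"
    using E fin lm by (intro measure_mono_fmeasurable) auto
  finally show ?thesis .
qed

text \<open>Around each point of the copy of \<open>D\<close> contracted towards \<open>a\<close>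
  there is a ball of radius \<open>t * e\<close> inside \<open>D\<close>. A set of smaller diameter
  meeting the copy therefore stays in the interior of \<open>D\<close> and cannot reach the
  frontier.\<close>

lemma touching_disjoint_shrunken:
  assumes D: "convex D" "ball a e \<subseteq> D"
    and K: "touches_boundary D K" "\<And>x y. x \<in> K \<Longrightarrow> y \<in> K \<Longrightarrow> norm (x - y) < t * e"
    and t: "0 < t" "t \<le> 1"
  shows "K \<inter> (\<lambda>x. (1 - t) *\<^sub>R x + t *\<^sub>R a) ` D = {}"
proof (rule ccontr)
  assume "\<not> ?thesis"
  then obtain y where y: "y \<in> D" "(1 - t) *\<^sub>R y + t *\<^sub>R a \<in> K" by auto
  define x where "x = (1 - t) *\<^sub>R y + t *\<^sub>R a"
  obtain p where p: "p \<in> K" "p \<in> frontier D" using K(1) by (auto simp: touches_boundary_def)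
  \<comment> \<open>Each \<open>q\<close> in this ball is a convex combination, with weights
    \<open>1 - t\<close> and \<open>t\<close>, of \<open>y\<close> and a point of
    \<open>ball a e\<close>.\<close>
  have "ball x (t * e) \<subseteq> D"
  proof
    fix q assume "q \<in> ball x (t * e)"
    then have "norm (q - x) < t * e" by (simp add: dist_norm norm_minus_commute)
    moreover have "norm ((1 / t) *\<^sub>R (q - x)) = norm (q - x) / t" using t by simp
    ultimately have "norm ((1 / t) *\<^sub>R (q - x)) < e"
      using t by (simp only: pos_divide_less_eq mult.commute)
    then have "a + (1 / t) *\<^sub>R (q - x) \<in> D" using D(2) by (auto simp: dist_norm)
    then have "(1 - t) *\<^sub>R y + t *\<^sub>R (a + (1 / t) *\<^sub>R (q - x)) \<in> D"
      using D(1) y(1) t by (intro convexD) auto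
    moreover have "(1 - t) *\<^sub>R y + t *\<^sub>R (a + (1 / t) *\<^sub>R (q - x)) = q"
      using t by (simp add: x_def scaleR_add_right)
    ultimately show "q \<in> D" by simp
  qed
  then have "ball x (t * e) \<subseteq> interior D" by (intro interior_maximal) auto
  moreover have "p \<in> ball x (t * e)"
    using K(2)[OF _ p(1), of x] y by (simp add: x_def dist_norm)
  ultimately show False using p(2) by (auto simp: frontier_def)
qed

text \<open>The contracted copy has \<open>(1 - t)^2\<close> times the area of \<open>D\<close>,
  which leaves the fraction \<open>2 * t - t^2\<close> for the layer.\<close>

lemma measure_boundary_layer:
  fixes D :: "(real^2) set"
  assumes D: "compact D" "convex D" "a \<in> D" and t: "0 \<le> t" "t \<le> 1"
  shows "measure lebesgue (D - (\<lambda>x. (1 - t) *\<^sub>R x + t *\<^sub>R a) ` D) \<le> 2 * t * measure lebesgue D"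
proof -
  let ?h = "\<lambda>x. (1 - t) *\<^sub>R x + t *\<^sub>R a"
  have "?h ` D \<subseteq> D" using D t by (auto intro!: convexD)
  moreover have "?h ` D \<in> lmeasurable"
    using D(1) by (intro lmeasurable_compact compact_continuous_image continuous_intros)
  ultimately have "measure lebesgue (D - ?h ` D) = measure lebesgue D - measure lebesgue (?h ` D)"
    using D by (intro measurable_measure_Diff) (auto simp: lmeasurable_compact fmeasurableD)
  also have "\<dots> = (2 * t - t\<^sup>2) * measure lebesgue D"
    unfolding measure_homothet by (simp add: power2_eq_square algebra_simps)
  also have "\<dots> \<le> 2 * t * measure lebesgue D" by (intro mult_right_mono) auto
  finally show ?thesis .
qed

text \<open>Members of diameter at most \<open>d\<close> fit into a boundary layer of area
  \<open>O(d)\<close>. The constant is chosen before \<open>S\<close> and \<open>d\<close>, so that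
  it serves every dyadic class of a packing at once.\<close>

lemma sum_area_touching_le:
  assumes D: "convex_body D"
  obtains c where "0 \<le> c"
    and "\<And>S d. packing_in D S \<Longrightarrow> (\<forall>K\<in>S. touches_boundary D K) \<Longrightarrow> 0 < d \<Longrightarrow>
           (\<And>K x y. K \<in> S \<Longrightarrow> x \<in> K \<Longrightarrow> y \<in> K \<Longrightarrow> norm (x - y) \<le> d) \<Longrightarrow>
           (\<Sum>K\<in>S. measure lebesgue K) \<le> c * d"
proof -
  obtain a e where ae: "0 < e" "ball a e \<subseteq> D"
    using D by (auto simp: convex_body_def mem_interior)
  have aD: "a \<in> D" using ae centre_in_ball by blast
  have cD: "compact D" "convex D" using D by (auto simp: convex_body_def)
  have "(\<Sum>K\<in>S. measure lebesgue K) \<le> 4 * measure lebesgue D / e * d"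
    if S: "packing_in D S" "\<forall>K\<in>S. touches_boundary D K" and d: "0 < d"
      and dS: "\<And>K x y. K \<in> S \<Longrightarrow> x \<in> K \<Longrightarrow> y \<in> K \<Longrightarrow> norm (x - y) \<le> d" for S d
  proof -
    \<comment> \<open>The factor 2 gives the strict inequality \<open>d < t * e\<close> that
      disjointness from the shrunken copy requires.\<close>
    define t where "t = 2 * d / e"
    have t: "0 < t" "d < t * e" using ae d by (auto simp: t_def)
    have "(\<Sum>K\<in>S. measure lebesgue K) \<le> 2 * t * measure lebesgue D"
    proof (cases "t \<le> 1")
      case True
      let ?E = "D - (\<lambda>x. (1 - t) *\<^sub>R x + t *\<^sub>R a) ` D"
      have "?E \<in> lmeasurable"
        using cD by (intro fmeasurable_Diff lmeasurable_compact fmeasurableD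
            compact_continuous_image continuous_intros)
      moreover have "K \<subseteq> ?E" if "K \<in> S" for K
      proof -
        have "norm (x - y) < t * e" if "x \<in> K" "y \<in> K" for x y
          using dS[OF \<open>K \<in> S\<close> that] t by linarith
        then have "K \<inter> (\<lambda>x. (1 - t) *\<^sub>R x + t *\<^sub>R a) ` D = {}"
          using S that t True by (intro touching_disjoint_shrunken[OF cD(2) ae(2)]) auto
        then show ?thesis using S that by (auto simp: packing_in_def)
      qed
      ultimately show ?thesis
        using sum_measure_packing_le[OF S(1)] measure_boundary_layer[OF cD aD _ True] t
        by fastforce
    next
      \<comment> \<open>For \<open>t > 1\<close> there is no shrunken copy, but then the whole area
        of \<open>D\<close> is already below the claimed bound.\<close>
      case False
      have "(\<Sum>K\<in>S. measure lebesgue K) \<le> 1 * measure lebesgue D"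
        using sum_measure_packing_le[OF S(1) lmeasurable_compact[OF cD(1)]] S
        by (auto simp: packing_in_def)
      also have "\<dots> \<le> 2 * t * measure lebesgue D" using False by (intro mult_right_mono) auto
      finally show ?thesis .
    qed
    also have "\<dots> = 4 * measure lebesgue D / e * d" by (simp add: t_def)
    finally show ?thesis .
  qed
  moreover have "0 \<le> 4 * measure lebesgue D / e" using ae by simp
  ultimately show thesis using that by blast
qed

subsection \<open>Dyadic summation\<close>

text \<open>The first \<open>k\<close> halvings of \<open>M\<close>, with \<open>k\<close> about
  \<open>log 2 n\<close>, cost at most \<open>A\<close> each. The remaining values are so small that
  even \<open>n\<close> of them sum to at most \<open>M\<close>.\<close>

lemma dyadic_sum_le:
  fixes r :: "'a \<Rightarrow> real"
  assumes fin: "finite S" and M: "0 < M" "\<And>x. x \<in> S \<Longrightarrow> r x \<le> M" and A: "0 \<le> A"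
    and dyadic: "\<And>\<mu>. 0 < \<mu> \<Longrightarrow> (\<Sum>x | x \<in> S \<and> \<mu> / 2 < r x \<and> r x \<le> \<mu>. r x) \<le> A"
    and n: "card S = n" "2 \<le> n"
  shows "(\<Sum>x\<in>S. r x) \<le> (2 * A + M) * log 2 n"
proof -
  have large: "(\<Sum>x | x \<in> S \<and> M / 2 ^ k < r x. r x) \<le> A * k" for k
  proof (induction k)
    case 0
    \<comment> \<open>No value exceeds \<open>M\<close>, so the induction starts from an empty
      sum.\<close>
    have none: "{x \<in> S. M / 2 ^ 0 < r x} = {}" using M by fastforce
    show ?case unfolding none by simp
  next
    case (Suc k)
    let ?\<mu> = "M / 2 ^ k"
    have "{x \<in> S. M / 2 ^ Suc k < r x} =
        {x \<in> S. ?\<mu> < r x} \<union> {x \<in> S. ?\<mu> / 2 < r x \<and> r x \<le> ?\<mu>}" (is "?L = _")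
    proof -
      have half: "y / 2 < y" if "0 < y" for y :: real using that by simp
      have "?\<mu> / 2 < ?\<mu>" by (rule half) (use M(1) in simp)
      moreover have "M / 2 ^ Suc k = ?\<mu> / 2" by simp
      ultimately show ?thesis by auto
    qed
    then have "sum r ?L = sum r {x \<in> S. ?\<mu> < r x} + sum r {x \<in> S. ?\<mu> / 2 < r x \<and> r x \<le> ?\<mu>}"
      by (subst sum.union_disjoint[symmetric]) (use fin in auto)
    also have "\<dots> \<le> A * k + A" using Suc.IH dyadic[of ?\<mu>] M by (intro add_mono) auto
    finally show ?case by (simp add: algebra_simps)
  qed
  define l where "l = log 2 n"
  \<comment> \<open>This is where \<open>2 \<le> n\<close> enters: it lets the rounding in
    \<open>k\<close> be absorbed into \<open>2 * l\<close> and the additive \<open>M\<close> into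
    \<open>M * l\<close>.\<close>
  have l1: "1 \<le> l" using n by (simp add: l_def le_log_iff)
  define k where "k = nat \<lceil>l\<rceil>"
  have k: "l \<le> k" "real k \<le> 2 * l" using l1 unfolding k_def by linarith+
  have "real n = 2 powr l" using n by (simp add: l_def)
  also have "\<dots> \<le> 2 powr k" using k by (intro powr_mono) auto
  finally have nk: "real n \<le> 2 ^ k" by (simp add: powr_realpow)
  have "(\<Sum>x | x \<in> S \<and> r x \<le> M / 2 ^ k. r x) \<le> (\<Sum>x | x \<in> S \<and> r x \<le> M / 2 ^ k. M / 2 ^ k)"
    by (rule sum_mono) auto
  also have "\<dots> = card {x \<in> S. r x \<le> M / 2 ^ k} * (M / 2 ^ k)" by simp
  also have "\<dots> \<le> 2 ^ k * (M / 2 ^ k)"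
  proof (intro mult_right_mono)
    have "card {x \<in> S. r x \<le> M / 2 ^ k} \<le> card S" by (rule card_mono) (use fin in auto)
    then have "real (card {x \<in> S. r x \<le> M / 2 ^ k}) \<le> real n" using n(1) by simp
    then show "real (card {x \<in> S. r x \<le> M / 2 ^ k}) \<le> 2 ^ k" using nk by linarith
  qed (use M in auto)
  finally have small: "(\<Sum>x | x \<in> S \<and> r x \<le> M / 2 ^ k. r x) \<le> M" by simp
  have "S = {x \<in> S. M / 2 ^ k < r x} \<union> {x \<in> S. r x \<le> M / 2 ^ k}" by auto
  then have "(\<Sum>x\<in>S. r x) = (\<Sum>x \<in> {x \<in> S. M / 2 ^ k < r x} \<union> {x \<in> S. r x \<le> M / 2 ^ k}. r x)"
    by (rule arg_cong)
  also have "\<dots> = (\<Sum>x | x \<in> S \<and> M / 2 ^ k < r x. r x) + (\<Sum>x | x \<in> S \<and> r x \<le> M / 2 ^ k. r x)"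
    by (rule sum.union_disjoint) (use fin in auto)
  also have "\<dots> \<le> A * k + M" using large small by (rule add_mono)
  also have "\<dots> \<le> A * (2 * l) + M * l"
    using k l1 A M by (intro add_mono mult_left_mono) auto
  finally show ?thesis by (simp add: l_def algebra_simps)
qed

text \<open>For \<open>n = 1\<close> the right-hand side would be 0 while a single body has positive
  perimeter, hence the condition \<open>2 \<le> n\<close>.\<close>

theorem proposition2:
  fixes C D :: "(real^2) set"
  assumes "convex_body C" and "convex_body D"
  shows "\<exists>\<rho>::real. \<forall>(n::nat) (S::(real^2) set set).
           2 \<le> n \<longrightarrow> card S = n \<longrightarrow> packing_in D S \<longrightarrow>
           (\<forall>K\<in>S. positive_homothet C K) \<longrightarrow> (\<forall>K\<in>S. touches_boundary D K) \<longrightarrow>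
           (\<Sum>K\<in>S. perimeter K) \<le> ennreal (\<rho> * log 2 (real n))"
proof -
  obtain P where P: "0 \<le> P"
    "\<And>\<mu> v. 0 < \<mu> \<Longrightarrow> perimeter ((\<lambda>x. \<mu> *\<^sub>R x + v) ` C) \<le> ennreal (\<mu> * P)"
    using perimeter_homothet_le[OF assms(1)] by blast
  obtain c where c: "0 \<le> c"
    "\<And>S d. packing_in D S \<Longrightarrow> (\<forall>K\<in>S. touches_boundary D K) \<Longrightarrow> 0 < d \<Longrightarrow>
       (\<And>K x y. K \<in> S \<Longrightarrow> x \<in> K \<Longrightarrow> y \<in> K \<Longrightarrow> norm (x - y) \<le> d) \<Longrightarrow>
       (\<Sum>K\<in>S. measure lebesgue K) \<le> c * d"
    using sum_area_touching_le[OF assms(2)] by blast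
  define \<alpha> where "\<alpha> = measure lebesgue C"
  define \<beta> where "\<beta> = measure lebesgue D"
  have \<alpha>: "0 < \<alpha>" and \<beta>: "0 < \<beta>"
    using assms by (simp_all add: \<alpha>_def \<beta>_def measure_convex_body_pos)
  have "bounded C" using assms(1) by (auto simp: convex_body_def compact_imp_bounded)
  then obtain B0 where B0: "\<And>x. x \<in> C \<Longrightarrow> norm x \<le> B0" by (auto simp: bounded_iff)
  \<comment> \<open>\<open>B\<close> bounds the diameter of \<open>C\<close>; the summand 1 keeps it
    positive.\<close>
  define B where "B = 2 * \<bar>B0\<bar> + 1"
  have B: "0 < B" "\<And>x y. x \<in> C \<Longrightarrow> y \<in> C \<Longrightarrow> norm (x - y) \<le> B"
  proof -
    show "norm (x - y) \<le> B" if "x \<in> C" "y \<in> C" for x y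
      using B0[OF that(1)] B0[OF that(2)] norm_triangle_ineq4[of x y] unfolding B_def by linarith
  qed (simp add: B_def)
  \<comment> \<open>\<open>M\<close> caps the scales: a homothet of scale \<open>r\<close> has area
    \<open>r^2 * \<alpha>\<close>, at most the area \<beta> of \<open>D\<close>.\<close>
  define M where "M = sqrt (\<beta> / \<alpha>)"
  \<comment> \<open>\<open>A\<close> bounds the sum of the scales in one dyadic class: the class has
    total area at most \<open>c * (\<mu> * B)\<close>, each scale is at most
    \<open>2 / (\<mu> * \<alpha>)\<close> times its area, and \<mu> cancels.\<close>
  define A where "A = 2 * c * B / \<alpha>"
  have M: "0 < M" and A: "0 \<le> A" using \<alpha> \<beta> c B by (auto simp: M_def A_def)
  have main: "(\<Sum>K\<in>S. perimeter K) \<le> ennreal ((2 * A + M) * P * log 2 (real n))"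
    if n: "2 \<le> n" "card S = n" and S: "packing_in D S"
      and hom: "\<forall>K\<in>S. positive_homothet C K" and touch: "\<forall>K\<in>S. touches_boundary D K" for n S
  proof -
    have fin: "finite S" using S by (simp add: packing_in_def)
    obtain r v where rv: "\<And>K. K \<in> S \<Longrightarrow> 0 < r K \<and> K = (\<lambda>x. r K *\<^sub>R x + v K) ` C"
      using hom unfolding positive_homothet_def by metis
    have area: "measure lebesgue K = (r K)\<^sup>2 * \<alpha>" if "K \<in> S" for K
      using rv[OF that] measure_homothet[of "r K" "v K" C] by (simp add: \<alpha>_def)
    have rM: "r K \<le> M" if "K \<in> S" for K
    proof -
      have "measure lebesgue K \<le> \<beta>" unfolding \<beta>_def
        using S that assms(2)
        by (intro measure_mono_fmeasurable)
          (auto simp: packing_in_def convex_body_def lmeasurable_compact fmeasurableD)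
      then have "(r K)\<^sup>2 \<le> \<beta> / \<alpha>" using area[OF that] \<alpha> by (simp add: field_simps)
      then show ?thesis unfolding M_def by (rule real_le_rsqrt)
    qed
    have "(\<Sum>K | K \<in> S \<and> \<mu> / 2 < r K \<and> r K \<le> \<mu>. r K) \<le> A" if \<mu>: "0 < \<mu>" for \<mu>
    proof -
      let ?T = "{K \<in> S. \<mu> / 2 < r K \<and> r K \<le> \<mu>}"
      have "(\<Sum>K\<in>?T. measure lebesgue K) \<le> c * (\<mu> * B)"
      proof (rule c(2))
        show "packing_in D ?T"
          using S by (auto simp: packing_in_def intro: pairwise_subset)
        show "\<forall>K\<in>?T. touches_boundary D K" using touch by auto
        show "0 < \<mu> * B" using \<mu> B by simp
        fix K x y assume K: "K \<in> ?T" "x \<in> K" "y \<in> K"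
        then have "K = (\<lambda>x. r K *\<^sub>R x + v K) ` C" using rv by auto
        then obtain x' y' where xy: "x' \<in> C" "y' \<in> C" "x = r K *\<^sub>R x' + v K" "y = r K *\<^sub>R y' + v K"
          using K by blast
        have "0 < r K" using rv K by auto
        then have "norm (x - y) = r K * norm (x' - y')"
          by (simp add: xy flip: scaleR_diff_right)
        also have "\<dots> \<le> \<mu> * B" using K \<open>0 < r K\<close> B xy by (intro mult_mono) auto
        finally show "norm (x - y) \<le> \<mu> * B" .
      qed
      moreover have "(\<Sum>K\<in>?T. r K) \<le> (\<Sum>K\<in>?T. 2 / (\<mu> * \<alpha>) * measure lebesgue K)"
      proof (rule sum_mono)
        fix K assume K: "K \<in> ?T"
        \<comment> \<open>The lower end of the dyadic class trades a scale for its square, that is,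
          for an area.\<close>
        then have "r K * (\<mu> / 2) \<le> r K * r K" using rv by (intro mult_left_mono) auto
        then have "r K \<le> 2 / \<mu> * (r K)\<^sup>2" using \<mu> by (simp add: field_simps power2_eq_square)
        also have "\<dots> = 2 / (\<mu> * \<alpha>) * measure lebesgue K"
          using K area \<alpha> by (simp add: field_simps)
        finally show "r K \<le> 2 / (\<mu> * \<alpha>) * measure lebesgue K" .
      qed
      ultimately have "(\<Sum>K\<in>?T. r K) \<le> 2 / (\<mu> * \<alpha>) * (c * (\<mu> * B))"
        using \<mu> \<alpha> unfolding sum_distrib_left[symmetric]
        by (elim order_trans) (intro mult_left_mono, auto)
      also have "\<dots> = A" using \<mu> by (simp add: A_def)
      finally show ?thesis .
    qed
    then have sum_r: "(\<Sum>K\<in>S. r K) \<le> (2 * A + M) * log 2 n"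
      by (intro dyadic_sum_le[OF fin M _ A _ n(2,1)] rM)
    have "(\<Sum>K\<in>S. perimeter K) \<le> (\<Sum>K\<in>S. ennreal (r K * P))"
    proof (rule sum_mono)
      fix K assume "K \<in> S"
      then show "perimeter K \<le> ennreal (r K * P)"
        using rv[of K] P(2)[of "r K" "v K"] by simp
    qed
    also have "\<dots> = ennreal (\<Sum>K\<in>S. r K * P)"
      using rv P by (intro sum_ennreal) (simp add: less_imp_le)
    also have "\<dots> \<le> ennreal ((2 * A + M) * P * log 2 n)"
    proof (rule ennreal_leI)
      have "(\<Sum>K\<in>S. r K * P) = (\<Sum>K\<in>S. r K) * P" by (rule sum_distrib_right[symmetric])
      also have "\<dots> \<le> (2 * A + M) * log 2 n * P"
        using sum_r P(1) by (rule mult_right_mono)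
      finally show "(\<Sum>K\<in>S. r K * P) \<le> (2 * A + M) * P * log 2 n"
        by (simp only: mult.assoc mult.commute[of P])
    qed
    finally show ?thesis .
  qed
  then show ?thesis by blast
qed

end
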